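(* Let $S:X\to X$ be a nonsingular $m$-transformation of a normalized measure space $(X,\mathcal{B},\mu)$. The following three statements are equivalent: (1) $S$ is ergodic; (2) for any $B\in\mathcal{B}$ such that $\mu(B\setminus S^{-1}(B))=\mu(B^c\setminus S^{-1}(B^c))=0$, one has $\mu(B)=0$ or $\mu(B^c)=0$; (3) for any disjoint sets $B_1,B_2\in\mathcal{B}$ such that $\mu(B_1\setminus S^{-1}(B_1))=\mu(B_2\setminus S^{-1}(B_2))=0$, one has $\mu(B_1)=0$ or $\mu(B_2)=0$.
   Context: $(X,\mathcal{B},\mu)$ is a normalized measure space, i.e. $\mu(X)=1$, and $m$ is a positive integer. An $m$-transformation $S:X\to X$ is a multivalued map assigning to each $x\in X$ a subset $S(x)\subset X$ with $1\le |S(x)|\le m$, where $|A|$ is the number of elements of $A$. For $B\subset X$ and $k,l\in\mathbb{N}$ put $S^{-1}_{k;l}(B)=\{x\in X: |S(x)|=k,\ |S(x)\cap B|=l\}$. $S$ is measurable if $S^{-1}_{k;l}(B)\in\mathcal{B}$ for all $B\in\mathcal{B}$ and $k,l\in\mathbb{N}$. $S^{-1}(B)=\{x\in X: S(x)\cap B\ne\emptyset\}$ is the full preimage of $B$, and $B^c=X\setminus B$. $S$ is nonsingular if it is measurable and $\mu(S^{-1}(B))=0$ for every $B\in\mathcal{B}$ with $\mu(B)=0$. A nonsingular $m$-transformation $S$ is ergodic if for any $B\in\mathcal{B}$ such that $B\setminus S^{-1}(B)=B^c\setminus S^{-1}(B^c)=\emptyset$, one has $\mu(B)=0$ or $\mu(B^c)=0$.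 *)

theory Defs
  imports "HOL-Probability.Probability"
begin

text \<open>
  A normalized measure space is a measure \<open>M\<close> with \<open>prob_space M\<close>; the underlying set \<open>X\<close> is
  \<open>space M\<close>, and complements are taken relative to \<open>space M\<close>. A multivalued map is a function
  \<open>S :: 'a \<Rightarrow> 'a set\<close>, of which only the values on \<open>space M\<close> are relevant. Since \<open>card\<close> is \<open>0\<close> on
  infinite sets, finiteness of the values is required explicitly.
\<close>

definition m_transformation :: "nat \<Rightarrow> 'a measure \<Rightarrow> ('a \<Rightarrow> 'a set) \<Rightarrow> bool" where
  "m_transformation m M S \<longleftrightarrow>
     0 < m \<and>
     (\<forall>x\<in>space M. S x \<subseteq> space M \<and> finite (S x) \<and> 1 \<le> card (S x) \<and> card (S x) \<le> m)"

definition card_preimage :: "'a measure \<Rightarrow> ('a \<Rightarrow> 'a set) \<Rightarrow> nat \<Rightarrow> nat \<Rightarrow> 'a set \<Rightarrow> 'a set" where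
  "card_preimage M S k l B = {x \<in> space M. card (S x) = k \<and> card (S x \<inter> B) = l}"

definition full_preimage :: "'a measure \<Rightarrow> ('a \<Rightarrow> 'a set) \<Rightarrow> 'a set \<Rightarrow> 'a set" where
  "full_preimage M S B = {x \<in> space M. S x \<inter> B \<noteq> {}}"

definition measurable_m_transformation :: "nat \<Rightarrow> 'a measure \<Rightarrow> ('a \<Rightarrow> 'a set) \<Rightarrow> bool" where
  "measurable_m_transformation m M S \<longleftrightarrow>
     m_transformation m M S \<and>
     (\<forall>B\<in>sets M. \<forall>k l. card_preimage M S k l B \<in> sets M)"

definition nonsingular_m_transformation :: "nat \<Rightarrow> 'a measure \<Rightarrow> ('a \<Rightarrow> 'a set) \<Rightarrow> bool" where
  "nonsingular_m_transformation m M S \<longleftrightarrow>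
     measurable_m_transformation m M S \<and>
     (\<forall>B\<in>sets M. emeasure M B = 0 \<longrightarrow> emeasure M (full_preimage M S B) = 0)"

text \<open>The invariance condition here is set-theoretic, not merely up to null sets.\<close>

definition ergodic_m_transformation :: "nat \<Rightarrow> 'a measure \<Rightarrow> ('a \<Rightarrow> 'a set) \<Rightarrow> bool" where
  "ergodic_m_transformation m M S \<longleftrightarrow>
     nonsingular_m_transformation m M S \<and>
     (\<forall>B\<in>sets M.
        B - full_preimage M S B = {} \<and>
        (space M - B) - full_preimage M S (space M - B) = {} \<longrightarrow>
        emeasure M B = 0 \<or> emeasure M (space M - B) = 0)"

end

theory Submission
  imports Defs
begin

text \<open>
  The implications from (3) to (2) and from (2) to (1) are immediate. For the implication from (1)
  to (3), let the core of \<open>B\<close> be the set of points of \<open>B\<close> from which \<open>S\<close> allows one to stay in \<open>B\<close>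
  for arbitrarily many steps. As \<open>S\<close> has finite values, the core is the largest subset \<open>C\<close> of \<open>B\<close>
  with \<open>C \<subseteq> S\<^sup>-\<^sup>1(C)\<close>; by nonsingularity it has full measure in \<open>B\<close> whenever \<open>B - S\<^sup>-\<^sup>1(B)\<close> is null.
  Let \<open>C\<^sub>1, C\<^sub>2\<close> be the cores of \<open>B\<^sub>1, B\<^sub>2\<close>, and let \<open>A\<close> be the core of the complement of \<open>C\<^sub>2\<close>,
  which contains \<open>C\<^sub>1\<close>. A point outside \<open>A\<close> has an image outside \<open>A\<close>: points of \<open>C\<^sub>2\<close> have one in
  \<open>C\<^sub>2\<close>, and a point outside \<open>C\<^sub>2\<close> with an image in \<open>A\<close> would itself belong to \<open>A\<close>. Ergodicity
  applied to \<open>A\<close> concludes.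
\<close>

text \<open>Stage \<open>n\<close> holds the points that start a path of \<open>n\<close> steps
  inside \<open>B\<close>. Intersecting with the previous stage instead of \<open>B\<close> gives
  the same sets and makes the sequence visibly decreasing.\<close>

primrec stay_set :: "'a measure \<Rightarrow> ('a \<Rightarrow> 'a set) \<Rightarrow> 'a set \<Rightarrow> nat \<Rightarrow> 'a set" where
  "stay_set M S B 0 = B"
| "stay_set M S B (Suc n) = stay_set M S B n \<inter> full_preimage M S (stay_set M S B n)"

definition stay_core :: "'a measure \<Rightarrow> ('a \<Rightarrow> 'a set) \<Rightarrow> 'a set \<Rightarrow> 'a set" where
  "stay_core M S B = (\<Inter>n. stay_set M S B n)"

lemma full_preimage_mono: "A \<subseteq> B \<Longrightarrow> full_preimage M S A \<subseteq> full_preimage M S B"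
  by (auto simp: full_preimage_def)

lemma full_preimage_diff_subset:
  "full_preimage M S A - full_preimage M S B \<subseteq> full_preimage M S (A - B)"
  by (auto simp: full_preimage_def)

lemma full_preimage_sets:
  assumes "measurable_m_transformation m M S" and "B \<in> sets M"
  shows "full_preimage M S B \<in> sets M"
proof -
  have fin: "finite (S x)" if "x \<in> space M" for x
    using assms(1) that by (simp add: measurable_m_transformation_def m_transformation_def)
  \<comment> \<open>For finite \<open>S x\<close>, meeting \<open>B\<close> means that
    \<open>card (S x \<inter> B)\<close> is a successor; the union is countable.\<close>
  have "full_preimage M S B = (\<Union>k. \<Union>l. card_preimage M S k (Suc l) B)"
    using fin by (auto simp: full_preimage_def card_preimage_def
        simp flip: card_gt_0_iff gr0_conv_Suc)
  moreover have "card_preimage M S k l B \<in> sets M" for k l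
    using assms by (simp add: measurable_m_transformation_def)
  ultimately show ?thesis
    by auto
qed

lemma stay_set_sets:
  assumes "measurable_m_transformation m M S" and "B \<in> sets M"
  shows "stay_set M S B n \<in> sets M"
  using assms by (induction n) (auto intro: full_preimage_sets)

lemma stay_core_sets:
  assumes "measurable_m_transformation m M S" and "B \<in> sets M"
  shows "stay_core M S B \<in> sets M"
  unfolding stay_core_def using stay_set_sets[OF assms] by auto

lemma stay_core_subset: "stay_core M S B \<subseteq> B"
  unfolding stay_core_def by (metis INT_lower UNIV_I stay_set.simps(1))

lemma decseq_stay_set: "decseq (stay_set M S B)"
  by (rule decseq_SucI) simp

text \<open>A compactness argument: if each of the finitely many points of \<open>F\<close> left the
  sequence at some stage, all would be gone by the largest of these stages.\<close>

lemma decseq_finite_Int_Inter: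
  assumes "decseq E" and "finite F" and "\<And>n. F \<inter> E n \<noteq> {}"
  shows "F \<inter> (\<Inter>n. E n) \<noteq> {}"
proof
  assume "F \<inter> (\<Inter>n. E n) = {}"
  then have "\<forall>y\<in>F. \<exists>n. y \<notin> E n"
    by auto
  then obtain f where f: "\<And>y. y \<in> F \<Longrightarrow> y \<notin> E (f y)"
    by metis
  obtain N where N: "\<And>y. y \<in> F \<Longrightarrow> f y \<le> N"
    using finite_nat_set_iff_bounded_le[of "f ` F"] assms(2) by auto
  obtain y where "y \<in> F" "y \<in> E N"
    using assms(3)[of N] by auto
  then show False
    using f N decseqD[OF assms(1)] by blast
qed

lemma stay_core_subinvariant:
  assumes "m_transformation m M S" and "B \<subseteq> space M"
  shows "stay_core M S B \<subseteq> full_preimage M S (stay_core M S B)"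
proof
  fix x
  assume x: "x \<in> stay_core M S B"
  then have "x \<in> space M"
    using stay_core_subset[of M S B] assms(2) by auto
  moreover have "S x \<inter> stay_set M S B n \<noteq> {}" for n
  proof -
    have "x \<in> stay_set M S B (Suc n)"
      using x unfolding stay_core_def by blast
    then show ?thesis
      by (simp add: full_preimage_def)
  qed
  moreover have "finite (S x)"
    using assms(1) \<open>x \<in> space M\<close> by (simp add: m_transformation_def)
  ultimately show "x \<in> full_preimage M S (stay_core M S B)"
    using decseq_finite_Int_Inter[OF decseq_stay_set, of "S x" M S B]
    unfolding full_preimage_def stay_core_def by blast
qed

text \<open>Prepending a point of \<open>B\<close> to paths that stay in \<open>B\<close>
  arbitrarily long gives such paths again.\<close>

lemma Int_full_preimage_stay_core_subset:
  "B \<inter> full_preimage M S (stay_core M S B) \<subseteq> stay_core M S B"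
proof -
  have "B \<inter> full_preimage M S (stay_core M S B) \<subseteq> stay_set M S B n" for n
  proof (induction n)
    case (Suc n)
    have "stay_core M S B \<subseteq> stay_set M S B n"
      by (auto simp: stay_core_def)
    then show ?case
      using Suc full_preimage_mono[of "stay_core M S B" "stay_set M S B n" M S] by auto
  qed simp
  then show ?thesis
    by (auto simp: stay_core_def)
qed

lemma stay_core_greatest:
  assumes "C \<subseteq> B" and "C \<subseteq> full_preimage M S C"
  shows "C \<subseteq> stay_core M S B"
proof -
  have "C \<subseteq> stay_set M S B n" for n
  proof (induction n)
    case (Suc n)
    then show ?case
      using assms(2) full_preimage_mono[OF Suc, of M S] by auto
  qed (use assms(1) in simp)
  then show ?thesis
    by (auto simp: stay_core_def)
qed

text \<open>The part of \<open>B\<close> outside the core is the countable union of the layers lost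
  from one stage to the next, and nonsingularity carries nullity from each layer to the following
  one.\<close>

lemma diff_stay_core_null:
  assumes S: "nonsingular_m_transformation m M S" and B: "B \<in> sets M"
    and null: "B - full_preimage M S B \<in> null_sets M"
  shows "B - stay_core M S B \<in> null_sets M"
proof -
  let ?E = "stay_set M S B"
  have meas: "measurable_m_transformation m M S"
    using S by (simp add: nonsingular_m_transformation_def)
  have E: "?E n \<in> sets M" for n
    using stay_set_sets[OF meas B] .
  have step: "?E n - ?E (Suc n) \<in> null_sets M" for n
  proof (induction n)
    case 0
    then show ?case
      using null by (simp add: Diff_Int)
  next
    case (Suc n)
    then have "full_preimage M S (?E n - ?E (Suc n)) \<in> null_sets M"
      using S full_preimage_sets[OF meas]
      by (auto simp: nonsingular_m_transformation_def null_sets_def simp del: stay_set.simps)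
    \<comment> \<open>A point lost now has an image in \<open>?E n\<close> but none in
      \<open>?E (Suc n)\<close>, so that image was lost one stage earlier.\<close>
    moreover have "?E (Suc n) - ?E (Suc (Suc n)) \<subseteq> full_preimage M S (?E n - ?E (Suc n))"
      using full_preimage_diff_subset[of M S "?E n" "?E (Suc n)"] by auto
    ultimately show ?case
      using E by (meson null_sets_subset sets.Diff)
  qed
  have "B - ?E n \<subseteq> (\<Union>k. ?E k - ?E (Suc k))" for n
    by (induction n) auto
  then have "B - stay_core M S B \<subseteq> (\<Union>k. ?E k - ?E (Suc k))"
    unfolding stay_core_def by blast
  moreover have "(\<Union>k. ?E k - ?E (Suc k)) \<in> null_sets M"
    using step by blast
  ultimately show ?thesis
    using B stay_core_sets[OF meas B] by (meson null_sets_subset sets.Diff)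
qed

lemma ergodic_disjoint_subinvariant:
  assumes erg: "ergodic_m_transformation m M S"
    and "C1 \<in> sets M" and "C2 \<in> sets M" and "C1 \<inter> C2 = {}"
    and "C1 \<subseteq> full_preimage M S C1" and "C2 \<subseteq> full_preimage M S C2"
  shows "C1 \<in> null_sets M \<or> C2 \<in> null_sets M"
proof -
  have meas: "measurable_m_transformation m M S" and S: "m_transformation m M S"
    using erg by (auto simp: ergodic_m_transformation_def nonsingular_m_transformation_def
        measurable_m_transformation_def)
  define D where "D = space M - C2"
  define A where "A = stay_core M S D"
  have D: "D \<in> sets M"
    using assms(3) by (simp add: D_def)
  have A: "A \<in> sets M"
    unfolding A_def using stay_core_sets[OF meas D] .
  have "A \<subseteq> D"
    unfolding A_def by (rule stay_core_subset)
  have "C1 \<subseteq> A"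
    unfolding A_def using assms(4,5) sets.sets_into_space[OF assms(2)]
    by (intro stay_core_greatest) (auto simp: D_def)
  have "A \<subseteq> full_preimage M S A"
    unfolding A_def using stay_core_subinvariant[OF S sets.sets_into_space[OF D]] .
  moreover have "space M - A \<subseteq> full_preimage M S (space M - A)"
  proof
    fix x
    assume x: "x \<in> space M - A"
    then have Sx: "S x \<subseteq> space M" "S x \<noteq> {}"
      using S by (auto simp: m_transformation_def)
    show "x \<in> full_preimage M S (space M - A)"
    proof (cases "x \<in> C2")
      case True
      then have "S x \<inter> C2 \<noteq> {}"
        using assms(6) by (auto simp: full_preimage_def)
      then show ?thesis
        using x Sx \<open>A \<subseteq> D\<close> by (auto simp: full_preimage_def D_def)
    next
      case False
      \<comment> \<open>Since \<open>x\<close> lies in \<open>D\<close> but not in its core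
        \<open>A\<close>, no image of \<open>x\<close> is in \<open>A\<close>; as \<open>S x\<close>
        is nonempty, some image is outside.\<close>
      then have "x \<notin> full_preimage M S A"
        using x Int_full_preimage_stay_core_subset[of D M S] by (auto simp: A_def D_def)
      then show ?thesis
        using x Sx by (auto simp: full_preimage_def)
    qed
  qed
  ultimately have "emeasure M A = 0 \<or> emeasure M (space M - A) = 0"
    using erg A by (auto simp: ergodic_m_transformation_def)
  then have "A \<in> null_sets M \<or> space M - A \<in> null_sets M"
    using A by auto
  moreover have "C2 \<subseteq> space M - A"
    using \<open>A \<subseteq> D\<close> sets.sets_into_space[OF assms(3)] by (auto simp: D_def)
  ultimately show ?thesis
    using assms(2,3) \<open>C1 \<subseteq> A\<close> by (meson null_sets_subset)
qed

text \<open>Passing to cores turns almost-everywhere inclusions into exact ones, at the cost of null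
  sets only.\<close>

lemma ergodic_disjoint_almost_subinvariant:
  assumes erg: "ergodic_m_transformation m M S"
    and B1: "B1 \<in> sets M" and B2: "B2 \<in> sets M" and "B1 \<inter> B2 = {}"
    and "B1 - full_preimage M S B1 \<in> null_sets M"
    and "B2 - full_preimage M S B2 \<in> null_sets M"
  shows "B1 \<in> null_sets M \<or> B2 \<in> null_sets M"
proof -
  let ?C = "stay_core M S"
  have ns: "nonsingular_m_transformation m M S"
    using erg by (simp add: ergodic_m_transformation_def)
  then have meas: "measurable_m_transformation m M S" and S: "m_transformation m M S"
    by (auto simp: nonsingular_m_transformation_def measurable_m_transformation_def)
  have "?C B1 \<in> null_sets M \<or> ?C B2 \<in> null_sets M"
  proof (rule ergodic_disjoint_subinvariant[OF erg])
    show "?C B1 \<inter> ?C B2 = {}"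
      using assms(4) stay_core_subset[of M S B1] stay_core_subset[of M S B2] by auto
  qed (rule B1 B2 sets.sets_into_space stay_core_sets[OF meas] stay_core_subinvariant[OF S])+
  moreover have "B \<in> null_sets M"
    if "B \<in> sets M" "B - full_preimage M S B \<in> null_sets M" "?C B \<in> null_sets M" for B
  proof -
    have "B = (B - ?C B) \<union> ?C B"
      using stay_core_subset[of M S B] by blast
    then show ?thesis
      using diff_stay_core_null[OF ns that(1,2)] that(3) by (metis null_sets.Un)
  qed
  ultimately show ?thesis
    using assms by blast
qed

theorem theorem2:
  fixes M :: "'a measure" and m :: nat and S :: "'a \<Rightarrow> 'a set"
  assumes "prob_space M"
    and "nonsingular_m_transformation m M S"
  shows "(ergodic_m_transformation m M S \<longleftrightarrow>
           (\<forall>B\<in>sets M.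
              emeasure M (B - full_preimage M S B) = 0 \<and>
              emeasure M ((space M - B) - full_preimage M S (space M - B)) = 0 \<longrightarrow>
              emeasure M B = 0 \<or> emeasure M (space M - B) = 0))
       \<and> (ergodic_m_transformation m M S \<longleftrightarrow>
           (\<forall>B1\<in>sets M. \<forall>B2\<in>sets M.
              B1 \<inter> B2 = {} \<and>
              emeasure M (B1 - full_preimage M S B1) = 0 \<and>
              emeasure M (B2 - full_preimage M S B2) = 0 \<longrightarrow>
              emeasure M B1 = 0 \<or> emeasure M B2 = 0))"
proof -
  let ?two = "\<forall>B\<in>sets M.
              emeasure M (B - full_preimage M S B) = 0 \<and>
              emeasure M ((space M - B) - full_preimage M S (space M - B)) = 0 \<longrightarrow>
              emeasure M B = 0 \<or> emeasure M (space M - B) = 0"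
  let ?three = "\<forall>B1\<in>sets M. \<forall>B2\<in>sets M.
              B1 \<inter> B2 = {} \<and>
              emeasure M (B1 - full_preimage M S B1) = 0 \<and>
              emeasure M (B2 - full_preimage M S B2) = 0 \<longrightarrow>
              emeasure M B1 = 0 \<or> emeasure M B2 = 0"
  have "?three" if erg: "ergodic_m_transformation m M S"
  proof (intro ballI impI)
    fix B1 B2
    assume B: "B1 \<in> sets M" "B2 \<in> sets M"
      and *: "B1 \<inter> B2 = {} \<and> emeasure M (B1 - full_preimage M S B1) = 0 \<and>
        emeasure M (B2 - full_preimage M S B2) = 0"
    \<comment> \<open>Measurability is needed to pass to \<open>null_sets\<close>:
      \<open>emeasure\<close> also takes the value 0 on every nonmeasurable set.\<close>
    have "full_preimage M S B \<in> sets M" if "B \<in> sets M" for B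
      using assms(2) that full_preimage_sets by (auto simp: nonsingular_m_transformation_def)
    then have "B1 \<in> null_sets M \<or> B2 \<in> null_sets M"
      using ergodic_disjoint_almost_subinvariant[OF erg B] B * by (simp add: null_sets_def)
    then show "emeasure M B1 = 0 \<or> emeasure M B2 = 0"
      by auto
  qed
  moreover have "?two" if three: "?three"
  proof
    fix B
    assume B: "B \<in> sets M"
    have "B \<inter> (space M - B) = {}"
      by blast
    then show "emeasure M (B - full_preimage M S B) = 0 \<and>
        emeasure M ((space M - B) - full_preimage M S (space M - B)) = 0 \<longrightarrow>
        emeasure M B = 0 \<or> emeasure M (space M - B) = 0"
      using three[rule_format, OF B sets.compl_sets[OF B]] by blast
  qed
  moreover have "ergodic_m_transformation m M S" if two: "?two"
    unfolding ergodic_m_transformation_def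
  proof (intro conjI ballI impI)
    show "nonsingular_m_transformation m M S"
      by (rule assms(2))
  next
    fix B
    assume "B \<in> sets M"
      and "B - full_preimage M S B = {} \<and>
        (space M - B) - full_preimage M S (space M - B) = {}"
    then show "emeasure M B = 0 \<or> emeasure M (space M - B) = 0"
      \<comment> \<open>Exact inclusions are a special case of inclusions up to null sets, the
        differences being empty.\<close>
      using two by (metis emeasure_empty)
  qed
  ultimately show ?thesis
    by argo
qed

end
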